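(* Let $f:D\to\mathbb{R}$ be the bivariate fractal interpolation function associated, as described in the context, with a triangle $D$ partitioned into properly $3$-coloured subtriangles $D_1,\dots,D_N$, data values $z_{nj}$ and vertical scaling factors $\alpha_{n7}\in(-1,1)$. Then for every $n=1,\dots,N$ and every $(x,y)\in D_n$, $$f(x,y)=h(x,y)+\alpha_{n7}\,(f-b)\circ L_n^{-1}(x,y),$$ where $z=h(x,y)$ on $D_n$ is the equation of the plane passing through the three points $(x_{nj},y_{nj},z_{nj})$, $j=1,2,3$, over the vertices of $D_n$, and $z=b(x,y)$ is the equation of the plane passing through the three points $(x_j,y_j,z_j)$, $j=1,2,3$, over the vertices of $D$.
   Context: Setting. $D\subset\mathbb{R}^2$ is a (non-degenerate, closed) triangle with vertices $(x_1,y_1),(x_2,y_2),(x_3,y_3)$. It is partitioned into $N$ non-degenerate closed subtriangles $D_1,\dots,D_N$: $D=\bigcup_{n=1}^N D_n$, where distinct subtriangles meet only along common edges or at common vertices (or not at all). The graph of the partition (vertices: the vertices of the subtriangles; edges: the sides of the subtriangles) has chromatic number $3$, and a proper colouring of its vertices with colours $1,2,3$ is fixed such that the vertex $(x_j,y_j)$ of $D$ has colour $j$ for $j=1,2,3$. For each $n$, $(x_{nj},y_{nj})$ denotes the vertex of $D_n$ of colour $j$, $j=1,2,3$. Real values are prescribed at the vertices of the partition; $z_{nj}$ is the value at $(x_{nj},y_{nj})$ (so it depends only on the point), and $z_j$ is the value at $(x_j,y_j)$. Maps. For each $n$, $L_n:\mathbb{R}^2\to\mathbb{R}^2$ is the invertible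 affine map $L_n(x,y)=(\alpha_{n1}x+\alpha_{n2}y+\beta_{n1},\ \alpha_{n3}x+\alpha_{n4}y+\beta_{n2})$ determined by $L_n(x_j,y_j)=(x_{nj},y_{nj})$, $j=1,2,3$ (so $L_n(D)=D_n$). Given vertical scaling factors $\alpha_{n7}\in(-1,1)$, put $F_n(x,y,z)=Q_n(x,y)+\alpha_{n7}z$ with $Q_n(x,y)=\alpha_{n5}x+\alpha_{n6}y+\beta_{n3}$, where $\alpha_{n5},\alpha_{n6},\beta_{n3}$ are determined by $F_n(x_j,y_j,z_j)=z_{nj}$, $j=1,2,3$. The bivariate fractal interpolation function $f$ of these data is the unique continuous function $f:D\to\mathbb{R}$ with $f(x_{nj},y_{nj})=z_{nj}$ for all $n,j$ and $$f(x,y)=F_n\big(L_n^{-1}(x,y),f(L_n^{-1}(x,y))\big)=\alpha_{n7}f(L_n^{-1}(x,y))+Q_n(L_n^{-1}(x,y)),\qquad (x,y)\in D_n,\ n=1,\dots,N.$$ *)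

theory Defs
  imports "HOL-Analysis.Analysis"
begin

type_synonym point = "real \<times> real"

definition proper_colouring :: "'a set \<Rightarrow> 'a set set \<Rightarrow> nat \<Rightarrow> ('a \<Rightarrow> nat) \<Rightarrow> bool" where
  "proper_colouring V E k c \<longleftrightarrow>
     c ` V \<subseteq> {1..k} \<and> (\<forall>u v. {u, v} \<in> E \<longrightarrow> c u \<noteq> c v)"

definition chromatic_number :: "'a set \<Rightarrow> 'a set set \<Rightarrow> nat" where
  "chromatic_number V E = (LEAST k. \<exists>c. proper_colouring V E k c)"

text \<open>A nondegenerate closed triangle is a 2-simplex in the plane; its vertices are its extreme
  points and its sides are the sets \<open>e\<close> with \<open>e edge_of T\<close>.\<close>

definition triangle_partition :: "point set \<Rightarrow> nat \<Rightarrow> (nat \<Rightarrow> point set) \<Rightarrow> bool" where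
  "triangle_partition D N T \<longleftrightarrow>
     2 simplex D \<and>
     (\<forall>n\<in>{1..N}. 2 simplex T n) \<and>
     D = (\<Union>n\<in>{1..N}. T n) \<and>
     (\<forall>m\<in>{1..N}. \<forall>n\<in>{1..N}. m \<noteq> n \<longrightarrow>
        T m \<inter> T n = {} \<or>
        (\<exists>v. v extreme_point_of T m \<and> v extreme_point_of T n \<and> T m \<inter> T n = {v}) \<or>
        (\<exists>e. e edge_of T m \<and> e edge_of T n \<and> T m \<inter> T n = e))"

definition partition_vertices :: "nat \<Rightarrow> (nat \<Rightarrow> point set) \<Rightarrow> point set" where
  "partition_vertices N T = (\<Union>n\<in>{1..N}. {v. v extreme_point_of T n})"

definition partition_edges :: "nat \<Rightarrow> (nat \<Rightarrow> point set) \<Rightarrow> point set set" where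
  "partition_edges N T = {{u, v} | u v. \<exists>n\<in>{1..N}. closed_segment u v edge_of T n}"

definition coloured_vertex :: "(point \<Rightarrow> nat) \<Rightarrow> point set \<Rightarrow> nat \<Rightarrow> point" where
  "coloured_vertex c S j = (THE v. v extreme_point_of S \<and> c v = j)"

text \<open>In the maps below, \<open>\<alpha> n i\<close> and \<open>\<beta> n i\<close> stand for $\alpha_{ni}$ and $\beta_{ni}$.\<close>

definition L_map :: "(nat \<Rightarrow> nat \<Rightarrow> real) \<Rightarrow> (nat \<Rightarrow> nat \<Rightarrow> real) \<Rightarrow> nat \<Rightarrow> point \<Rightarrow> point" where
  "L_map \<alpha> \<beta> n = (\<lambda>(x, y). (\<alpha> n 1 * x + \<alpha> n 2 * y + \<beta> n 1, \<alpha> n 3 * x + \<alpha> n 4 * y + \<beta> n 2))"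

definition Q_map :: "(nat \<Rightarrow> nat \<Rightarrow> real) \<Rightarrow> (nat \<Rightarrow> nat \<Rightarrow> real) \<Rightarrow> nat \<Rightarrow> point \<Rightarrow> real" where
  "Q_map \<alpha> \<beta> n = (\<lambda>(x, y). \<alpha> n 5 * x + \<alpha> n 6 * y + \<beta> n 3)"

definition F_map :: "(nat \<Rightarrow> nat \<Rightarrow> real) \<Rightarrow> (nat \<Rightarrow> nat \<Rightarrow> real) \<Rightarrow> nat \<Rightarrow> point \<Rightarrow> real \<Rightarrow> real" where
  "F_map \<alpha> \<beta> n p z = Q_map \<alpha> \<beta> n p + \<alpha> n 7 * z"

text \<open>\<open>V j\<close> is the vertex of \<open>D\<close> of colour \<open>j\<close>, and \<open>z v\<close> is the value prescribed at the partition
  vertex \<open>v\<close>; \<open>c\<close> and \<open>z\<close> are only relevant on the vertices of the partition. The last three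
  assumptions determine all the coefficients except the free scaling factors \<open>\<alpha> n 7\<close>.\<close>

locale bfif_data =
  fixes D :: "point set" and V :: "nat \<Rightarrow> point"
    and N :: nat and T :: "nat \<Rightarrow> point set"
    and c :: "point \<Rightarrow> nat" and z :: "point \<Rightarrow> real"
    and \<alpha> \<beta> :: "nat \<Rightarrow> nat \<Rightarrow> real"
  assumes partition: "triangle_partition D N T"
    and corners: "bij_betw V {1..3} {v. v extreme_point_of D}"
    and chromatic: "chromatic_number (partition_vertices N T) (partition_edges N T) = 3"
    and colouring: "proper_colouring (partition_vertices N T) (partition_edges N T) 3 c"
    and corner_colour: "\<And>j. j \<in> {1..3} \<Longrightarrow> c (V j) = j"
    and scaling: "\<And>n. n \<in> {1..N} \<Longrightarrow> \<alpha> n 7 \<in> {-1<..<1}"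
    and L_corner: "\<And>n j. n \<in> {1..N} \<Longrightarrow> j \<in> {1..3} \<Longrightarrow>
           L_map \<alpha> \<beta> n (V j) = coloured_vertex c (T n) j"
    and F_corner: "\<And>n j. n \<in> {1..N} \<Longrightarrow> j \<in> {1..3} \<Longrightarrow>
           F_map \<alpha> \<beta> n (V j) (z (V j)) = z (coloured_vertex c (T n) j)"

text \<open>Values of \<open>f\<close> outside \<open>D\<close> are irrelevant. For \<open>bfif_data\<close> there is at most one such \<open>f\<close> on
  \<open>D\<close>: the difference \<open>g\<close> of two of them satisfies $g = \alpha_{n7}\, g \circ L_n^{-1}$ on each
  \<open>T n\<close>, so its maximum modulus over \<open>D\<close> is 0.\<close>

definition is_bfif ::
  "point set \<Rightarrow> nat \<Rightarrow> (nat \<Rightarrow> point set) \<Rightarrow> (point \<Rightarrow> nat) \<Rightarrow> (point \<Rightarrow> real) \<Rightarrow>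
   (nat \<Rightarrow> nat \<Rightarrow> real) \<Rightarrow> (nat \<Rightarrow> nat \<Rightarrow> real) \<Rightarrow> (point \<Rightarrow> real) \<Rightarrow> bool" where
  "is_bfif D N T c z \<alpha> \<beta> f \<longleftrightarrow>
     continuous_on D f \<and>
     (\<forall>n\<in>{1..N}. \<forall>j\<in>{1..3}. f (coloured_vertex c (T n) j) = z (coloured_vertex c (T n) j)) \<and>
     (\<forall>n\<in>{1..N}. \<forall>p\<in>T n.
        f p = F_map \<alpha> \<beta> n (inv (L_map \<alpha> \<beta> n) p) (f (inv (L_map \<alpha> \<beta> n) p)))"

text \<open>\<open>t = plane_fun v w p\<close> is the equation of the plane in space through the points
  \<open>(v j, w j)\<close>, \<open>j = 1, 2, 3\<close>, where \<open>v 1\<close>, \<open>v 2\<close>, \<open>v 3\<close> are assumed not collinear.\<close>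

definition plane_fun :: "(nat \<Rightarrow> point) \<Rightarrow> (nat \<Rightarrow> real) \<Rightarrow> point \<Rightarrow> real" where
  "plane_fun v w p = (THE t. (p, t) \<in> affine hull ((\<lambda>j. (v j, w j)) ` {1..3}))"

end

(* Everything is affine: writing q in D in barycentric coordinates u with respect to the corners,
   L_n q has the same coordinates with respect to the coloured vertices of D_n, and evaluating Q_n
   at the corners by the interpolation condition on F_n gives
   Q_n q = (SUM j. u_j (z_nj - alpha_n7 z_j)) = h (L_n q) - alpha_n7 b q. *)

theory Submission
  imports Defs
begin

text \<open>Weights on the points \<open>v i\<close> and weights on the indices correspond because
  \<open>v\<close> is injective on \<open>I\<close>. Indexing by \<open>I\<close> lets one weight
  family \<open>u\<close> serve several point families at once: corners, coloured vertices, and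
  points of the graph.\<close>

lemma affine_hull_image_finite:
  fixes v :: "'i \<Rightarrow> 'a::real_vector"
  assumes "finite I" "inj_on v I"
  shows "affine hull (v ` I) = {\<Sum>i\<in>I. u i *\<^sub>R v i | u. sum u I = 1}"
proof (intro equalityI subsetI)
  fix x assume "x \<in> affine hull (v ` I)"
  then obtain u where "sum u (v ` I) = 1" "(\<Sum>y\<in>v ` I. u y *\<^sub>R y) = x"
    using assms by (auto simp: affine_hull_finite)
  then have "sum (u \<circ> v) I = 1" "x = (\<Sum>i\<in>I. (u \<circ> v) i *\<^sub>R v i)"
    using assms by (auto simp: sum.reindex)
  then show "x \<in> {\<Sum>i\<in>I. u i *\<^sub>R v i | u. sum u I = 1}"
    by blast
next
  fix x assume "x \<in> {\<Sum>i\<in>I. u i *\<^sub>R v i | u. sum u I = 1}"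
  then obtain u where "sum u I = 1" "x = (\<Sum>i\<in>I. u i *\<^sub>R v i)"
    by blast
  then have "sum (u \<circ> inv_into I v) (v ` I) = 1"
      "(\<Sum>y\<in>v ` I. (u \<circ> inv_into I v) y *\<^sub>R y) = x"
    using assms by (auto simp: sum.reindex)
  then show "x \<in> affine hull (v ` I)"
    using assms by (auto simp: affine_hull_finite)
qed

text \<open>Two different coordinate families would have a difference that is a nontrivial affine
  dependence.\<close>

lemma affine_independent_coordinates_unique:
  fixes v :: "'i \<Rightarrow> 'a::real_vector"
  assumes "finite I" "inj_on v I" "\<not> affine_dependent (v ` I)"
    and "sum u I = sum u' I" "(\<Sum>i\<in>I. u i *\<^sub>R v i) = (\<Sum>i\<in>I. u' i *\<^sub>R v i)"
    and "i \<in> I"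
  shows "u i = u' i"
proof (rule ccontr)
  assume ne: "u i \<noteq> u' i"
  define d where "d = (\<lambda>j. u j - u' j) \<circ> inv_into I v"
  have "sum d (v ` I) = 0" "(\<Sum>y\<in>v ` I. d y *\<^sub>R y) = 0"
    using assms by (auto simp: d_def sum.reindex sum_subtractf scaleR_diff_left)
  moreover have "d (v i) \<noteq> 0"
    using ne assms by (simp add: d_def)
  ultimately show False
    using assms by (auto simp: affine_dependent_explicit_finite)
qed

text \<open>The base point alone determines the weights, by affine independence of the
  \<open>v j\<close>; hence only one height \<open>t\<close> lies over it, as the definite
  description requires.\<close>

lemma plane_fun_barycentric:
  assumes "inj_on v {1..3}" "\<not> affine_dependent (v ` {1..3})" "sum u {1..3} = 1"
  shows "plane_fun v w (\<Sum>j\<in>{1..3}. u j *\<^sub>R v j) = (\<Sum>j\<in>{1..3}. u j * w j)"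
proof -
  have inj: "inj_on (\<lambda>j. (v j, w j)) {1..3}"
    using assms(1) by (auto simp: inj_on_def)
  have fst_snd: "(\<Sum>j\<in>{1..3}. u j *\<^sub>R (v j, w j)) =
      (\<Sum>j\<in>{1..3}. u j *\<^sub>R v j, \<Sum>j\<in>{1..3}. u j * w j)" for u :: "nat \<Rightarrow> real"
    by (simp add: sum_prod)
  show ?thesis
    unfolding plane_fun_def
  proof (rule the_equality)
    show "(\<Sum>j\<in>{1..3}. u j *\<^sub>R v j, \<Sum>j\<in>{1..3}. u j * w j)
        \<in> affine hull (\<lambda>j. (v j, w j)) ` {1..3}"
      using assms(3) unfolding affine_hull_image_finite[OF finite_atLeastAtMost inj] fst_snd
      by blast
  next
    fix t assume "(\<Sum>j\<in>{1..3}. u j *\<^sub>R v j, t) \<in> affine hull (\<lambda>j. (v j, w j)) ` {1..3}"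
    then obtain u' where u': "sum u' {1..3} = 1"
        "(\<Sum>j\<in>{1..3}. u j *\<^sub>R v j) = (\<Sum>j\<in>{1..3}. u' j *\<^sub>R v j)"
        "t = (\<Sum>j\<in>{1..3}. u' j * w j)"
      unfolding affine_hull_image_finite[OF finite_atLeastAtMost inj] fst_snd by blast
    have "u j = u' j" if "j \<in> {1..3}" for j
      using affine_independent_coordinates_unique[OF _ assms(1,2)] assms(3) u' that by simp
    with u'(3) show "t = (\<Sum>j\<in>{1..3}. u j * w j)"
      by simp
  qed
qed

text \<open>An affinely independent set is exactly the set of extreme points of its convex hull, so
  the set witnessing that \<open>S\<close> is a simplex is its set of extreme points.\<close>

lemma extreme_points_simplex:
  assumes "n simplex S"
  shows "\<not> affine_dependent {v. v extreme_point_of S}"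
    and "int (card {v. v extreme_point_of S}) = n + 1"
    and "S = convex hull {v. v extreme_point_of S}"
proof -
  obtain C where C: "\<not> affine_dependent C" "int (card C) = n + 1" "S = convex hull C"
    using assms by (auto simp: simplex_def)
  then have "{v. v extreme_point_of S} = C"
    by (auto simp: extreme_point_of_convex_hull_affine_independent)
  with C show "\<not> affine_dependent {v. v extreme_point_of S}"
    "int (card {v. v extreme_point_of S}) = n + 1" "S = convex hull {v. v extreme_point_of S}"
    by auto
qed

text \<open>Every subset of the vertices of a simplex spans a face, and two distinct points span one
  of dimension 1. Thus any two vertices of a subtriangle are adjacent in the coloured graph.\<close>

lemma closed_segment_edge_of_simplex:
  assumes "n simplex S" "u extreme_point_of S" "v extreme_point_of S" "u \<noteq> v"
  shows "closed_segment u v edge_of S"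
proof -
  have "convex hull {u, v} face_of convex hull {v. v extreme_point_of S}"
    unfolding face_of_convex_hull_affine_independent[OF extreme_points_simplex(1)[OF assms(1)]]
    using assms(2,3) by (intro exI[of _ "{u, v}"]) simp
  then show ?thesis
    using assms(4) extreme_points_simplex(3)[OF assms(1)]
    by (simp add: edge_of_def segment_convex_hull aff_dim_convex_hull aff_dim_2)
qed

text \<open>The three vertices are pairwise adjacent, so their colours differ, and only three
  colours are available.\<close>

lemma bij_betw_colour_simplex:
  assumes col: "proper_colouring (partition_vertices N T) (partition_edges N T) 3 c"
    and n: "n \<in> {1..N}" and simp: "2 simplex T n"
  shows "bij_betw c {v. v extreme_point_of T n} {1..3}"
proof -
  let ?E = "{v. v extreme_point_of T n}"
  have "{u, v} \<in> partition_edges N T" if "u \<in> ?E" "v \<in> ?E" "u \<noteq> v" for u v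
    using that n closed_segment_edge_of_simplex[OF simp, of u v]
    unfolding partition_edges_def by blast
  then have inj: "inj_on c ?E"
    using col unfolding proper_colouring_def inj_on_def by blast
  have "c ` ?E \<subseteq> {1..3}"
    using col n unfolding proper_colouring_def partition_vertices_def by blast
  moreover have "card (c ` ?E) = card {1..3::nat}"
    using extreme_points_simplex(2)[OF simp] inj by (simp add: card_image)
  ultimately show ?thesis
    using inj by (simp add: bij_betw_def card_subset_eq)
qed

text \<open>On the colours 1, 2, 3, \<open>coloured_vertex c S\<close> is the inverse of
  \<open>c\<close> restricted to the vertices.\<close>

lemma bij_betw_coloured_vertex:
  assumes "bij_betw c {v. v extreme_point_of S} {1..3}"
  shows "bij_betw (coloured_vertex c S) {1..3} {v. v extreme_point_of S}"
proof -
  let ?E = "{v. v extreme_point_of S}"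
  have "coloured_vertex c S j = inv_into ?E c j" if "j \<in> {1..3}" for j
    unfolding coloured_vertex_def
  proof (rule the_equality)
    show "inv_into ?E c j extreme_point_of S \<and> c (inv_into ?E c j) = j"
      using assms that inv_into_into[of j c ?E] by (simp add: bij_betw_def f_inv_into_f)
  next
    show "v = inv_into ?E c j" if "v extreme_point_of S \<and> c v = j" for v
      using assms that by (auto simp: bij_betw_def)
  qed
  then show ?thesis
    using bij_betw_inv_into[OF assms] bij_betw_cong by blast
qed

text \<open>Three affinely independent points span the whole plane, so \<open>p\<close> is arbitrary
  and the weights may be negative.\<close>

lemma triangle_barycentric:
  fixes v :: "nat \<Rightarrow> point"
  assumes simp: "2 simplex S" and bij: "bij_betw v {1..3} {x. x extreme_point_of S}"
  shows "inj_on v {1..3}" "\<not> affine_dependent (v ` {1..3})"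
    and "\<exists>u. sum u {1..3} = 1 \<and> p = (\<Sum>j\<in>{1..3}. u j *\<^sub>R v j)"
proof -
  show inj: "inj_on v {1..3}" and indep: "\<not> affine_dependent (v ` {1..3})"
    using bij extreme_points_simplex(1)[OF simp] by (auto simp: bij_betw_def)
  have "affine hull (v ` {1..3}) = UNIV"
    using indep inj by (intro affine_independent_span_eq) (simp_all add: card_image)
  then have "p \<in> {\<Sum>j\<in>{1..3}. u j *\<^sub>R v j | u. sum u {1..3} = 1}"
    using affine_hull_image_finite[OF _ inj] by simp
  then show "\<exists>u. sum u {1..3} = 1 \<and> p = (\<Sum>j\<in>{1..3}. u j *\<^sub>R v j)"
    by blast
qed

lemma L_map_affine_combination:
  assumes "sum u I = 1"
  shows "L_map \<alpha> \<beta> n (\<Sum>j\<in>I. u j *\<^sub>R v j) = (\<Sum>j\<in>I. u j *\<^sub>R L_map \<alpha> \<beta> n (v j))"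
proof -
  \<comment> \<open>Weights of total 1 reproduce the constant terms of the affine map.\<close>
  have k: "(\<Sum>j\<in>I. u j * k) = k" for k
    using assms by (simp add: sum_distrib_right[symmetric])
  show ?thesis
    by (simp add: prod_eq_iff L_map_def case_prod_beta fst_sum snd_sum sum_distrib_left
        sum.distrib k algebra_simps)
qed

lemma Q_map_affine_combination:
  assumes "sum u I = 1"
  shows "Q_map \<alpha> \<beta> n (\<Sum>j\<in>I. u j *\<^sub>R v j) = (\<Sum>j\<in>I. u j * Q_map \<alpha> \<beta> n (v j))"
proof -
  have k: "\<beta> n 3 = (\<Sum>j\<in>I. u j * \<beta> n 3)"
    using assms by (simp add: sum_distrib_right[symmetric])
  show ?thesis
    \<comment> \<open>\<open>k\<close> is applied by \<open>subst\<close> because its right-hand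
      side contains its left-hand side and would loop as a rewrite rule.\<close>
    by (simp add: Q_map_def case_prod_beta fst_sum snd_sum, subst k)
      (simp add: sum_distrib_left sum.distrib algebra_simps)
qed

theorem theorem4p1:
  fixes D :: "point set" and V :: "nat \<Rightarrow> point"
    and N :: nat and T :: "nat \<Rightarrow> point set"
    and c :: "point \<Rightarrow> nat" and z :: "point \<Rightarrow> real"
    and \<alpha> \<beta> :: "nat \<Rightarrow> nat \<Rightarrow> real" and f b :: "point \<Rightarrow> real"
    and h :: "nat \<Rightarrow> point \<Rightarrow> real"
  assumes "bfif_data D V N T c z \<alpha> \<beta>"
    and "is_bfif D N T c z \<alpha> \<beta> f"
    and "\<And>n. n \<in> {1..N} \<Longrightarrow>
           h n = plane_fun (coloured_vertex c (T n)) (\<lambda>j. z (coloured_vertex c (T n) j))"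
    and "b = plane_fun V (\<lambda>j. z (V j))"
  shows "\<forall>n\<in>{1..N}. \<forall>p\<in>T n.
           f p = h n p + \<alpha> n 7 * ((\<lambda>q. f q - b q) \<circ> inv (L_map \<alpha> \<beta> n)) p"
proof (intro ballI)
  interpret bfif_data D V N T c z \<alpha> \<beta>
    by fact
  fix n p assume n: "n \<in> {1..N}" and p: "p \<in> T n"
  let ?L = "L_map \<alpha> \<beta> n" and ?W = "coloured_vertex c (T n)"
  have D: "2 simplex D" and Tn: "2 simplex T n"
    using partition n by (auto simp: triangle_partition_def)
  note V = triangle_barycentric[OF D corners]
  note W = triangle_barycentric[OF Tn
      bij_betw_coloured_vertex[OF bij_betw_colour_simplex[OF colouring n Tn]]]
  have L: "?L (\<Sum>j\<in>{1..3}. u j *\<^sub>R V j) = (\<Sum>j\<in>{1..3}. u j *\<^sub>R ?W j)"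
    if "sum u {1..3} = 1" for u
    using that L_corner[OF n] by (simp add: L_map_affine_combination)
  define q where "q = inv ?L p"
  \<comment> \<open>The weights of \<open>p\<close> with respect to the coloured vertices, placed on
    the corners, give a preimage of \<open>p\<close>. Hence the preimage chosen by
    \<open>inv ?L\<close> really maps to \<open>p\<close>.\<close>
  have "p \<in> range ?L"
    using W(3)[of p] L[symmetric] by auto
  then have Lq: "?L q = p"
    by (simp add: q_def f_inv_into_f)
  obtain u where u: "sum u {1..3} = 1" "q = (\<Sum>j\<in>{1..3}. u j *\<^sub>R V j)"
    using V(3)[of q] by blast
  have b: "b q = (\<Sum>j\<in>{1..3}. u j * z (V j))"
    using plane_fun_barycentric[OF V(1,2) u(1)] u(2) assms(4) by simp
  have "p = (\<Sum>j\<in>{1..3}. u j *\<^sub>R ?W j)"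
    using L u Lq by simp
  then have h: "h n p = (\<Sum>j\<in>{1..3}. u j * z (?W j))"
    using plane_fun_barycentric[OF W(1,2) u(1)] assms(3)[OF n] by simp
  have "Q_map \<alpha> \<beta> n (V j) = z (?W j) - \<alpha> n 7 * z (V j)" if "j \<in> {1..3}" for j
    using F_corner[OF n that] by (simp add: F_map_def)
  then have "Q_map \<alpha> \<beta> n q = (\<Sum>j\<in>{1..3}. u j * (z (?W j) - \<alpha> n 7 * z (V j)))"
    using u by (simp add: Q_map_affine_combination)
  also have "\<dots> = h n p - \<alpha> n 7 * b q"
    by (simp add: h b sum_subtractf sum_distrib_left algebra_simps)
  finally have Q: "Q_map \<alpha> \<beta> n q = h n p - \<alpha> n 7 * b q" .
  have "f p = F_map \<alpha> \<beta> n q (f q)"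
    using assms(2) n p by (simp add: is_bfif_def q_def)
  then show "f p = h n p + \<alpha> n 7 * ((\<lambda>q. f q - b q) \<circ> inv ?L) p"
    using Q by (simp add: F_map_def q_def algebra_simps)
qed

end
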